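(* Let $N\ge1$ be an integer, let $\alpha,\beta,\tau_0,\tau_1,\tau_2,\tau_3,\tau_4\in\mathbb C$, and let $$W=\tau_1XY+\tau_2YX+\tau_3X+\tau_4Y+\tau_0\mathcal I ,$$ where $X$ is multiplication by $x$ and $Y$ is the Hahn difference operator with parameters $\alpha,\beta,N$. Put $$e_2=2(\tau_1+\tau_2)^2,$$ $$e_1=6\tau_4^2+3(\tau_1+\tau_2)\bigl(\tau_3+(2N+\beta-\alpha)\tau_4\bigr)-(\tau_1^2+\tau_2^2)\bigl(3N(\alpha+1)-2\bigr)-2\bigl(3N(\alpha+1)-5\bigr)\tau_1\tau_2 .$$ Then there exist constants $g_1,\dots,g_7\in\mathbb C$ (depending on the parameters $\alpha,\beta,N,\tau_0,\dots,\tau_4$) such that $$[Y,[Y,W]]=g_1Y^2+g_2\{Y,W\}+g_3Y+g_4W+g_5\mathcal I,$$ $$[W,[W,Y]]=e_1Y^2+e_2Y^3+g_2W^2+g_1\{Y,W\}+g_3W+g_6Y+g_7\mathcal I .$$ Moreover, $e_1=e_2=0$ if and only if $\tau_1+\tau_2=0$ and ($\tau_2+\tau_4=0$ or $\tau_2-\tau_4=0$).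
   Context: Operators act on polynomials in $x$; $T^{\pm}f(x)=f(x\pm1)$, $\mathcal I$ is the identity, $Xf(x)=xf(x)$, $[A,B]=AB-BA$, $\{A,B\}=AB+BA$. The Hahn difference operator with parameters $\alpha,\beta,N$ is $$Y=B(x)T^{+}+D(x)T^{-}-(B(x)+D(x))\mathcal I,\qquad B(x)=(x-N)(x+\alpha+1),\quad D(x)=x(x-\beta-N-1).$$ *)

theory Defs
  imports Complex_Main "HOL-Computational_Algebra.Polynomial"
begin

type_synonym operator = "complex poly \<Rightarrow> complex poly"

definition shift_plus :: operator where
  "shift_plus f = pcompose f [:1, 1:]"

definition shift_minus :: operator where
  "shift_minus f = pcompose f [:-1, 1:]"

definition mult_X :: operator where
  "mult_X f = [:0, 1:] * f"

definition hahn_B :: "complex \<Rightarrow> nat \<Rightarrow> complex poly" where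
  "hahn_B \<alpha> N = [:- of_nat N, 1:] * [:\<alpha> + 1, 1:]"

definition hahn_D :: "complex \<Rightarrow> nat \<Rightarrow> complex poly" where
  "hahn_D \<beta> N = [:0, 1:] * [:- \<beta> - of_nat N - 1, 1:]"

definition hahn_Y :: "complex \<Rightarrow> complex \<Rightarrow> nat \<Rightarrow> operator" where
  "hahn_Y \<alpha> \<beta> N f =
     hahn_B \<alpha> N * shift_plus f + hahn_D \<beta> N * shift_minus f
     - (hahn_B \<alpha> N + hahn_D \<beta> N) * f"

definition hahn_W ::
  "complex \<Rightarrow> complex \<Rightarrow> nat \<Rightarrow> complex \<Rightarrow> complex \<Rightarrow> complex \<Rightarrow> complex \<Rightarrow> complex \<Rightarrow> operator" where
  "hahn_W \<alpha> \<beta> N \<tau>0 \<tau>1 \<tau>2 \<tau>3 \<tau>4 f =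
     smult \<tau>1 (mult_X (hahn_Y \<alpha> \<beta> N f)) + smult \<tau>2 (hahn_Y \<alpha> \<beta> N (mult_X f))
     + smult \<tau>3 (mult_X f) + smult \<tau>4 (hahn_Y \<alpha> \<beta> N f) + smult \<tau>0 f"

definition op_comm :: "operator \<Rightarrow> operator \<Rightarrow> operator" where
  "op_comm A B f = A (B f) - B (A f)"

definition op_anticomm :: "operator \<Rightarrow> operator \<Rightarrow> operator" where
  "op_anticomm A B f = A (B f) + B (A f)"

lemma poly_shift_plus: "poly (shift_plus f) x = poly f (x + 1)"
  by (simp add: shift_plus_def poly_pcompose add.commute)

lemma poly_shift_minus: "poly (shift_minus f) x = poly f (x - 1)"
  by (simp add: shift_minus_def poly_pcompose)

lemma poly_mult_X: "poly (mult_X f) x = x * poly f x"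
  by (simp add: mult_X_def)

lemma poly_hahn_B: "poly (hahn_B \<alpha> N) x = (x - of_nat N) * (x + \<alpha> + 1)"
  by (simp add: hahn_B_def algebra_simps)

lemma poly_hahn_D: "poly (hahn_D \<beta> N) x = x * (x - \<beta> - of_nat N - 1)"
  by (simp add: hahn_D_def algebra_simps)

end

(* Compared pointwise, both relations are identities between linear combinations of
   f(x - 3), ..., f(x + 3) with polynomial coefficients. The constants g1, g2 are read off from the
   coefficient of f(x + 2), then g3, g4, g6 from that of f(x + 1) and g5, g7 from that of f(x). They
   depend on B and D only through their coefficients, so it suffices to treat arbitrary monic
   quadratics B, D with D(0) = 0. *)
theory Submission
  imports Defs
begin

lemma poly_hahn_Y:
  "poly (hahn_Y \<alpha> \<beta> N f) x =
     (x - of_nat N) * (x + \<alpha> + 1) * (poly f (x + 1) - poly f x)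
     + x * (x - \<beta> - of_nat N - 1) * (poly f (x - 1) - poly f x)"
  by (simp add: hahn_Y_def poly_hahn_B poly_hahn_D poly_shift_plus poly_shift_minus algebra_simps)

text \<open>Brings the arguments of iterated shifts to the form \<open>x + k\<close>, so that
  \<open>algebra\<close> sees equal values of \<open>f\<close> as the same indeterminate.\<close>

lemma shift_arith:
  fixes x :: "'a::comm_ring_1"
  shows "x + 1 + 1 = x + 2" "x + 1 - 1 = x" "x - 1 + 1 = x" "x - 1 - 1 = x - 2"
    "x + 2 + 1 = x + 3" "x + 2 - 1 = x + 1" "x - 2 - 1 = x - 3" "x - 2 + 1 = x - 1"
  by simp_all

text \<open>Here B(x) = \<open>x^2 + b1 * x + b0\<close> and D(x) = \<open>x^2 + d1 * x\<close>. In
  W the factor X acts before the shift in YX and after it in XY, so \<open>f (x + 1)\<close> gets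
  B(x) times \<tau>1 x + \<tau>2 (x + 1) + \<tau>4, and similarly for
  \<open>f (x - 1)\<close>.\<close>

locale quadratic_difference_operators =
  fixes b1 b0 d1 \<tau>0 \<tau>1 \<tau>2 \<tau>3 \<tau>4 :: complex and Y W :: operator
  assumes poly_Y: "poly (Y f) x =
      (x^2 + b1 * x + b0) * (poly f (x + 1) - poly f x)
      + (x^2 + d1 * x) * (poly f (x - 1) - poly f x)"
    and poly_W: "poly (W f) x =
      (x^2 + b1 * x + b0) * ((\<tau>1 + \<tau>2) * x + \<tau>4 + \<tau>2) * poly f (x + 1)
      + (x^2 + d1 * x) * ((\<tau>1 + \<tau>2) * x + \<tau>4 - \<tau>2) * poly f (x - 1)
      + (\<tau>3 * x + \<tau>0
         - ((\<tau>1 + \<tau>2) * x + \<tau>4) * (2 * x^2 + (b1 + d1) * x + b0)) * poly f x"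
begin

definition "g1 = (b1 + d1) * (\<tau>1 + \<tau>2) - 4 * \<tau>4"

definition "g3 = (b1 + d1) * \<tau>3 - 4 * \<tau>0 + b0 * (\<tau>1 + \<tau>2) * (b1 - d1 - 2)
  - \<tau>4 * (b1 - d1) * (b1 - d1 - 2)"

text \<open>On monomials Y is triangular with diagonal entries l(n) = n (n + b1 - d1 - 1), and
  (l(n+1) - l(n))^2 = 2 (l(n+1) + l(n)) + \<open>g4\<close>; the factor 2 is the constant
  g2.\<close>

definition "g4 = (b1 - d1) * (b1 - d1 - 2)"

definition "g5 = (b1 - d1 - 2) * (b0 * \<tau>3 - (b1 - d1) * \<tau>0)"

definition "g6 = \<tau>1 * \<tau>2 * (8 * b0 + 4 - 4 * b1 * d1 - 2 * (b1 - d1))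
  + \<tau>4^2 * (b1 - d1) * (b1 - d1 - 2) - 2 * b0 * (\<tau>1 + \<tau>2) * \<tau>4 * (b1 - d1 - 2)
  + b0 * (b0 - 2 * d1) * (\<tau>1 + \<tau>2)^2 - 2 * (b1 + d1) * ((\<tau>1 + \<tau>2) * \<tau>0 + \<tau>4 * \<tau>3)
  + 8 * \<tau>4 * \<tau>0 + (4 * b0 + 2) * (\<tau>1 + \<tau>2) * \<tau>3 + \<tau>3^2"

definition "g7 = 2 * b0 * \<tau>1 * \<tau>2 * (b0 - d1 * (b1 - d1))
  + (b1 - d1 - 2) * (\<tau>4 * \<tau>0 * (b1 - d1) - b0 * (\<tau>1 + \<tau>2) * \<tau>0 - b0 * \<tau>4 * \<tau>3)
  - (b1 + d1) * \<tau>3 * \<tau>0 + b0 * (b0 - 2 * d1) * (\<tau>1 + \<tau>2) * \<tau>3 + b0 * \<tau>3^2 + 2 * \<tau>0^2"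

text \<open>The terms in \<open>f (x + 3)\<close> and \<open>f (x - 3)\<close> cancel on the left:
  their coefficients contain a second difference of a linear function w(x) = (\<tau>1 + \<tau>2) x +
  \<tau>4 \<plusminus> \<tau>2.\<close>

lemma double_comm_Y:
  "op_comm Y (op_comm Y W) f =
     smult g1 (Y (Y f)) + smult 2 (op_anticomm Y W f)
     + smult g3 (Y f) + smult g4 (W f) + smult g5 f" (is "?L = ?R")
proof -
  have "poly ?L x = poly ?R x" for x
    unfolding op_comm_def op_anticomm_def poly_add poly_smult poly_diff poly_Y poly_W shift_arith
      g1_def g3_def g4_def g5_def
    by algebra
  then show ?thesis
    using poly_eq_poly_eq_iff by blast
qed

text \<open>At \<open>f (x + 3)\<close> the left side now leaves w(x) w(x+1) - 2 w(x) w(x+2) +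
  w(x+1) w(x+2) = 2 (\<tau>1 + \<tau>2)^2 for linear w of slope \<tau>1 + \<tau>2, which forces the
  cubic term with \<open>e2\<close>.\<close>

lemma double_comm_W:
  fixes e1 e2 :: complex
  assumes e1: "e1 = 6 * (\<tau>4^2 - \<tau>2^2)
      + (\<tau>1 + \<tau>2) * (3 * \<tau>3 - 3 * (b1 + d1) * \<tau>4 + (3 * b0 + 2) * (\<tau>1 + \<tau>2) + 6 * \<tau>2)"
    and e2: "e2 = 2 * (\<tau>1 + \<tau>2)^2"
  shows "op_comm W (op_comm W Y) f =
     smult e1 (Y (Y f)) + smult e2 (Y (Y (Y f)))
     + smult 2 (W (W f)) + smult g1 (op_anticomm Y W f)
     + smult g3 (W f) + smult g6 (Y f) + smult g7 f" (is "?L = ?R")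
proof -
  have "poly ?L x = poly ?R x" for x
    unfolding op_comm_def op_anticomm_def poly_add poly_smult poly_diff poly_Y poly_W shift_arith
      g1_def g3_def g6_def g7_def e1 e2
    by algebra
  then show ?thesis
    using poly_eq_poly_eq_iff by blast
qed

end

theorem mainTheorem5:
  fixes N :: nat and \<alpha> \<beta> \<tau>0 \<tau>1 \<tau>2 \<tau>3 \<tau>4 e1 e2 :: complex and Y W :: operator
  assumes N: "N \<ge> 1"
    and Y: "Y = hahn_Y \<alpha> \<beta> N"
    and W: "W = hahn_W \<alpha> \<beta> N \<tau>0 \<tau>1 \<tau>2 \<tau>3 \<tau>4"
    and e2: "e2 = 2 * (\<tau>1 + \<tau>2)^2"
    and e1: "e1 = 6 * \<tau>4^2
               + 3 * (\<tau>1 + \<tau>2) * (\<tau>3 + (2 * of_nat N + \<beta> - \<alpha>) * \<tau>4)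
               - (\<tau>1^2 + \<tau>2^2) * (3 * of_nat N * (\<alpha> + 1) - 2)
               - 2 * (3 * of_nat N * (\<alpha> + 1) - 5) * \<tau>1 * \<tau>2"
  shows "(\<exists>g1 g2 g3 g4 g5 g6 g7 :: complex.
            (\<forall>f. op_comm Y (op_comm Y W) f =
               smult g1 ((Y ^^ 2) f) + smult g2 (op_anticomm Y W f)
               + smult g3 (Y f) + smult g4 (W f) + smult g5 f) \<and>
            (\<forall>f. op_comm W (op_comm W Y) f =
               smult e1 ((Y ^^ 2) f) + smult e2 ((Y ^^ 3) f)
               + smult g2 ((W ^^ 2) f) + smult g1 (op_anticomm Y W f)
               + smult g3 (W f) + smult g6 (Y f) + smult g7 f))
         \<and> (e1 = 0 \<and> e2 = 0 \<longleftrightarrow> \<tau>1 + \<tau>2 = 0 \<and> (\<tau>2 + \<tau>4 = 0 \<or> \<tau>2 - \<tau>4 = 0))"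
proof -
  define b1 b0 d1 where "b1 = \<alpha> + 1 - of_nat N" and "b0 = - of_nat N * (\<alpha> + 1)"
    and "d1 = - \<beta> - of_nat N - 1"
  note coeffs = b1_def b0_def d1_def
  interpret quadratic_difference_operators b1 b0 d1 \<tau>0 \<tau>1 \<tau>2 \<tau>3 \<tau>4 Y W
  proof
    show "poly (Y f) x = (x^2 + b1 * x + b0) * (poly f (x + 1) - poly f x)
        + (x^2 + d1 * x) * (poly f (x - 1) - poly f x)" for f x
      unfolding Y poly_hahn_Y coeffs by algebra
    show "poly (W f) x = (x^2 + b1 * x + b0) * ((\<tau>1 + \<tau>2) * x + \<tau>4 + \<tau>2) * poly f (x + 1)
        + (x^2 + d1 * x) * ((\<tau>1 + \<tau>2) * x + \<tau>4 - \<tau>2) * poly f (x - 1)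
        + (\<tau>3 * x + \<tau>0
           - ((\<tau>1 + \<tau>2) * x + \<tau>4) * (2 * x^2 + (b1 + d1) * x + b0)) * poly f x" for f x
      unfolding W hahn_W_def poly_add poly_smult poly_hahn_Y poly_mult_X coeffs by algebra
  qed
  \<comment> \<open>Grouped so that only 6 (\<tau>4^2 - \<tau>2^2) survives when \<tau>1 + \<tau>2 =
    0, which is what \<open>e2 = 0\<close> means; this yields the final equivalence.\<close>
  have e1': "e1 = 6 * (\<tau>4^2 - \<tau>2^2)
      + (\<tau>1 + \<tau>2) * (3 * \<tau>3 - 3 * (b1 + d1) * \<tau>4 + (3 * b0 + 2) * (\<tau>1 + \<tau>2) + 6 * \<tau>2)"
    unfolding e1 coeffs by algebra
  have pow: "(Z ^^ 2) f = Z (Z f)" "(Z ^^ 3) f = Z (Z (Z f))" for Z :: operator and f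
    by (simp_all add: eval_nat_numeral)
  have "\<tau>4^2 - \<tau>2^2 = 0 \<longleftrightarrow> \<tau>2 + \<tau>4 = 0 \<or> \<tau>2 - \<tau>4 = 0"
    by (auto simp: power2_eq_iff add_eq_0_iff)
  then have "e1 = 0 \<and> e2 = 0 \<longleftrightarrow> \<tau>1 + \<tau>2 = 0 \<and> (\<tau>2 + \<tau>4 = 0 \<or> \<tau>2 - \<tau>4 = 0)"
    unfolding e1' e2 by auto
  \<comment> \<open>The witness for g2 is 2; the others are the constants of the locale.\<close>
  with double_comm_Y double_comm_W[OF e1' e2] show ?thesis
    unfolding pow by blast
qed

end
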